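(* For every $\mathbf{S}=(S,+,\cdot,0,1)\in\mathcal{V}$ with $1+1\neq 1$ in $\mathbf{S}$ we have $\mathcal{V}(\mathbf{S})=\mathcal{V}$. In particular, $\mathcal{V}(\mathbf{L}\oplus 1)=\mathcal{V}$ for every non-trivial bounded distributive lattice $\mathbf{L}$, and $\mathcal{V}(\mathbf{T}_3)=\mathcal{V}$.
   Context: A semiring is an algebra $\mathbf{S}=(S,+,\cdot,0,1)$ of type $(2,2,0,0)$ such that $(S,+,0)$ is a commutative monoid, $(S,\cdot,1)$ is a monoid, $\cdot$ distributes over $+$ (on both sides), and $x0=0x=0$ for all $x\in S$. It is commutative if $\cdot$ is commutative and multiplicatively idempotent if $xx=x$ for all $x\in S$. $\mathcal{V}$ denotes the variety of all commutative multiplicatively idempotent semirings satisfying the identity $x+y+xyz\approx x+y$. For a semiring $\mathbf{S}$, $\mathcal{V}(\mathbf{S})$ denotes the variety (in the language $(+,\cdot,0,1)$) generated by $\mathbf{S}$. For a non-trivial bounded distributive lattice $\mathbf{L}=(L,\vee,\wedge,0,a)$ (with least element $0$ and greatest element $a$) and an element $1\notin L$, $\mathbf{L}\oplus 1$ denotes the semiring $(S,+,\cdot,0,1)$ with $S:=L\cup\{1\}$ and operations: $x+y:=x\vee y$ if $x,y\neq 1$; $x+y:=1$ if $(x,y)\in\{(0,1),(1,0)\}$; $x+y:=a$ otherwise; and $xy:=x\wedge y$ if $x,y\neq 1$; $xy:=y$ if $x=1$; $xy:=x$ if $y=1$. $\mathbf{T}_3$ is the semiring $(\{0,a,1\},+,\cdot,0,1)$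 with three distinct elements in which $0$ is neutral for $+$, $a+a=a+1=1+a=1+1=a$, $1$ is neutral for $\cdot$, $0$ is absorbing for $\cdot$, and $aa=a$. *)

theory Defs
  imports "HOL-Algebra.Ring" "HOL-Algebra.Lattice" "HOL-Library.FuncSet"
begin

section \<open>Algebras, terms and identities in the language $(+,\cdot,0,1)$\<close>

text \<open>The record \<^type>\<open>ring\<close> of HOL-Algebra (carrier, \<open>\<otimes>\<close>, \<open>\<one>\<close>, \<open>\<zero>\<close>, \<open>\<oplus>\<close>)
  serves as the type of algebras of type $(2,2,0,0)$. Values of the operations outside the
  carrier are irrelevant to every notion below.\<close>

definition sr_algebra :: "'a ring \<Rightarrow> bool" where
  "sr_algebra A \<longleftrightarrow> \<zero>\<^bsub>A\<^esub> \<in> carrier A \<and> \<one>\<^bsub>A\<^esub> \<in> carrier A \<and>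
    (\<forall>x\<in>carrier A. \<forall>y\<in>carrier A. x \<oplus>\<^bsub>A\<^esub> y \<in> carrier A \<and> x \<otimes>\<^bsub>A\<^esub> y \<in> carrier A)"

datatype 'v sr_term =
    TVar 'v
  | TZero
  | TOne
  | TAdd "'v sr_term" "'v sr_term"
  | TMult "'v sr_term" "'v sr_term"

primrec sr_eval :: "'a ring \<Rightarrow> ('v \<Rightarrow> 'a) \<Rightarrow> 'v sr_term \<Rightarrow> 'a" where
  "sr_eval A v (TVar x) = v x"
| "sr_eval A v TZero = \<zero>\<^bsub>A\<^esub>"
| "sr_eval A v TOne = \<one>\<^bsub>A\<^esub>"
| "sr_eval A v (TAdd s t) = sr_eval A v s \<oplus>\<^bsub>A\<^esub> sr_eval A v t"
| "sr_eval A v (TMult s t) = sr_eval A v s \<otimes>\<^bsub>A\<^esub> sr_eval A v t"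

type_synonym sr_identity = "nat sr_term \<times> nat sr_term"

definition sr_satisfies :: "'a ring \<Rightarrow> sr_identity \<Rightarrow> bool" where
  "sr_satisfies A e \<longleftrightarrow>
    (\<forall>v. range v \<subseteq> carrier A \<longrightarrow> sr_eval A v (fst e) = sr_eval A v (snd e))"

text \<open>The members, with elements in \<^typ>\<open>'a\<close>, of the variety axiomatised by \<open>E\<close>.\<close>

definition sr_models :: "sr_identity set \<Rightarrow> 'a ring set" where
  "sr_models E = {A. sr_algebra A \<and> (\<forall>e\<in>E. sr_satisfies A e)}"

text \<open>The smallest variety containing \<open>S\<close>, as the intersection of all varieties containing \<open>S\<close>.
  Its members are not tied to the type of the elements of \<open>S\<close>. The theorem
  \<open>variety_generated_iff_HSP\<close> below shows that this is the closure of \<open>S\<close> under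
  homomorphic images, subalgebras and powers.\<close>

definition variety_generated :: "'a ring \<Rightarrow> 'b ring set" where
  "variety_generated S = \<Inter> {sr_models E | E. S \<in> sr_models E}"


section \<open>The variety $\mathcal{V}$ and the semirings $\mathbf{L}\oplus 1$ and $\mathbf{T}_3$\<close>

definition variety_V :: "'a ring set" where
  "variety_V = {R. semiring R \<and>
     (\<forall>x\<in>carrier R. \<forall>y\<in>carrier R. x \<otimes>\<^bsub>R\<^esub> y = y \<otimes>\<^bsub>R\<^esub> x) \<and>
     (\<forall>x\<in>carrier R. x \<otimes>\<^bsub>R\<^esub> x = x) \<and>
     (\<forall>x\<in>carrier R. \<forall>y\<in>carrier R. \<forall>z\<in>carrier R.
        x \<oplus>\<^bsub>R\<^esub> y \<oplus>\<^bsub>R\<^esub> x \<otimes>\<^bsub>R\<^esub> y \<otimes>\<^bsub>R\<^esub> z = x \<oplus>\<^bsub>R\<^esub> y)}"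

definition nontrivial_bounded_distrib_lattice :: "'a gorder \<Rightarrow> bool" where
  "nontrivial_bounded_distrib_lattice L \<longleftrightarrow> bounded_lattice L \<and>
     (\<forall>x\<in>carrier L. \<forall>y\<in>carrier L. \<forall>z\<in>carrier L.
        x \<sqinter>\<^bsub>L\<^esub> (y \<squnion>\<^bsub>L\<^esub> z) = (x \<sqinter>\<^bsub>L\<^esub> y) \<squnion>\<^bsub>L\<^esub> (x \<sqinter>\<^bsub>L\<^esub> z)) \<and>
     \<bottom>\<^bsub>L\<^esub> \<noteq> \<top>\<^bsub>L\<^esub>"

text \<open>$\mathbf{L}\oplus 1$, where the new element $1$ is \<open>e\<close>; meant for \<open>e \<notin> carrier L\<close>.\<close>

definition adjoin_one :: "'a gorder \<Rightarrow> 'a \<Rightarrow> 'a ring" where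
  "adjoin_one L e = \<lparr>
     carrier = insert e (carrier L),
     mult = (\<lambda>x y. if x \<noteq> e \<and> y \<noteq> e then x \<sqinter>\<^bsub>L\<^esub> y else if x = e then y else x),
     one = e,
     zero = \<bottom>\<^bsub>L\<^esub>,
     add = (\<lambda>x y. if x \<noteq> e \<and> y \<noteq> e then x \<squnion>\<^bsub>L\<^esub> y
                  else if (x, y) \<in> {(\<bottom>\<^bsub>L\<^esub>, e), (e, \<bottom>\<^bsub>L\<^esub>)} then e
                  else \<top>\<^bsub>L\<^esub>)\<rparr>"

datatype T3_elem = T3_0 | T3_a | T3_1

definition T3 :: "T3_elem ring" where
  "T3 = \<lparr>
     carrier = UNIV,
     mult = (\<lambda>x y. if x = T3_1 then y else if y = T3_1 then x
                   else if x = T3_0 \<or> y = T3_0 then T3_0 else T3_a),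
     one = T3_1,
     zero = T3_0,
     add = (\<lambda>x y. if x = T3_0 then y else if y = T3_0 then x else T3_a)\<rparr>"


section \<open>The generated variety is closure under H, S and P\<close>

definition sr_power :: "'i set \<Rightarrow> 'a ring \<Rightarrow> ('i \<Rightarrow> 'a) ring" where
  "sr_power I S = \<lparr>
     carrier = I \<rightarrow>\<^sub>E carrier S,
     mult = (\<lambda>f g. \<lambda>i\<in>I. f i \<otimes>\<^bsub>S\<^esub> g i),
     one = (\<lambda>i\<in>I. \<one>\<^bsub>S\<^esub>),
     zero = (\<lambda>i\<in>I. \<zero>\<^bsub>S\<^esub>),
     add = (\<lambda>f g. \<lambda>i\<in>I. f i \<oplus>\<^bsub>S\<^esub> g i)\<rparr>"

definition sr_subalgebra :: "'a set \<Rightarrow> 'a ring \<Rightarrow> bool" where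
  "sr_subalgebra B A \<longleftrightarrow> B \<subseteq> carrier A \<and> sr_algebra (A\<lparr>carrier := B\<rparr>)"

definition sr_hom :: "'a ring \<Rightarrow> 'b ring \<Rightarrow> ('a \<Rightarrow> 'b) set" where
  "sr_hom A B = {h \<in> ring_hom A B. h \<zero>\<^bsub>A\<^esub> = \<zero>\<^bsub>B\<^esub>}"

definition in_HSP :: "'i itself \<Rightarrow> 'b ring \<Rightarrow> 'a ring \<Rightarrow> bool" where
  "in_HSP _ A S \<longleftrightarrow> sr_algebra A \<and>
     (\<exists>(I :: 'i set) B h. sr_subalgebra B (sr_power I S) \<and>
        h \<in> sr_hom ((sr_power I S)\<lparr>carrier := B\<rparr>) A \<and> h ` B = carrier A)"

lemma sr_eval_closed:
  assumes "sr_algebra A" "\<And>x. x \<in> set_sr_term t \<Longrightarrow> v x \<in> carrier A"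
  shows "sr_eval A v t \<in> carrier A"
  using assms(2) by (induction t) (use assms(1) in \<open>auto simp: sr_algebra_def\<close>)

lemma sr_eval_cong:
  assumes "\<And>x. x \<in> set_sr_term t \<Longrightarrow> v x = w x"
  shows "sr_eval A v t = sr_eval A w t"
  using assms by (induction t) auto

lemma sr_eval_map: "sr_eval A v (map_sr_term f t) = sr_eval A (v \<circ> f) t"
  by (induction t) auto

lemma sr_eval_carrier [simp]: "sr_eval (A\<lparr>carrier := B\<rparr>) v t = sr_eval A v t"
  by (induction t) auto

lemma sr_eval_hom:
  assumes "sr_algebra A" "h \<in> sr_hom A B" "\<And>x. v x \<in> carrier A"
  shows "sr_eval B (h \<circ> v) t = h (sr_eval A v t)"
proof (induction t)
  case (TAdd s t)
  then show ?case
    using assms sr_eval_closed[OF assms(1), of _ v]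
    by (auto simp: sr_hom_def ring_hom_add)
next
  case (TMult s t)
  then show ?case
    using assms sr_eval_closed[OF assms(1), of _ v]
    by (auto simp: sr_hom_def ring_hom_mult)
qed (use assms in \<open>auto simp: sr_hom_def ring_hom_one\<close>)

lemma sr_eval_power:
  "i \<in> I \<Longrightarrow> sr_eval (sr_power I S) v t i = sr_eval S (\<lambda>x. v x i) t"
  by (induction t) (auto simp: sr_power_def)

lemma sr_algebra_power: "sr_algebra S \<Longrightarrow> sr_algebra (sr_power I S)"
  by (auto simp: sr_algebra_def sr_power_def PiE_iff)

lemma variety_generated_iff:
  assumes "sr_algebra S"
  shows "A \<in> variety_generated S \<longleftrightarrow>
    sr_algebra A \<and> (\<forall>e. sr_satisfies S e \<longrightarrow> sr_satisfies A e)"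
proof
  assume "A \<in> variety_generated S"
  moreover have "S \<in> sr_models {e. sr_satisfies S e}"
    using assms by (auto simp: sr_models_def)
  ultimately have "A \<in> sr_models {e. sr_satisfies S e}"
    unfolding variety_generated_def by blast
  then show "sr_algebra A \<and> (\<forall>e. sr_satisfies S e \<longrightarrow> sr_satisfies A e)"
    by (auto simp: sr_models_def)
qed (auto simp: variety_generated_def sr_models_def)

lemma in_HSP_imp_variety_generated:
  assumes S: "sr_algebra S" and "in_HSP TYPE('i) A S"
  shows "A \<in> variety_generated S"
proof -
  from assms(2) obtain I :: "'i set" and B h where A: "sr_algebra A"
    and B: "sr_subalgebra B (sr_power I S)"
    and h: "h \<in> sr_hom ((sr_power I S)\<lparr>carrier := B\<rparr>) A" and surj: "h ` B = carrier A"
    unfolding in_HSP_def by blast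
  let ?P = "(sr_power I S)\<lparr>carrier := B\<rparr>"
  have P: "sr_algebra ?P" and BP: "B \<subseteq> I \<rightarrow>\<^sub>E carrier S"
    using B by (auto simp: sr_subalgebra_def sr_power_def)
  have "sr_satisfies A e" if e: "sr_satisfies S e" for e
    unfolding sr_satisfies_def
  proof (intro allI impI)
    fix v :: "nat \<Rightarrow> 'b" assume "range v \<subseteq> carrier A"
    then have "\<forall>n. \<exists>b. b \<in> B \<and> h b = v n"
      using surj by (metis imageE range_subsetD)
    then obtain b where b: "\<And>n. b n \<in> B" "\<And>n. h (b n) = v n"
      by metis
    have hv: "h \<circ> b = v"
      using b by auto
    have ev: "sr_eval A v t = h (sr_eval ?P b t)" for t
      using sr_eval_hom[OF P h, of b t] b hv by simp
    have mem: "sr_eval ?P b t \<in> I \<rightarrow>\<^sub>E carrier S" for t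
      using sr_eval_closed[OF P, of t b] b BP by auto
    have "sr_eval ?P b (fst e) = sr_eval ?P b (snd e)"
    proof (rule PiE_ext[OF mem mem])
      fix i assume i: "i \<in> I"
      have "range (\<lambda>n. b n i) \<subseteq> carrier S"
        using b BP i by (auto dest!: PiE_mem[of _ I])
      then show "sr_eval ?P b (fst e) i = sr_eval ?P b (snd e) i"
        using e i by (simp add: sr_eval_power sr_satisfies_def)
    qed
    then show "sr_eval A v (fst e) = sr_eval A v (snd e)"
      by (simp only: ev)
  qed
  then show ?thesis
    using A by (simp add: variety_generated_iff[OF S])
qed

lemma variety_generated_imp_in_HSP:
  fixes S :: "'a ring" and A :: "'b ring"
  assumes S: "sr_algebra S" and AS: "A \<in> variety_generated S"
  shows "in_HSP TYPE('b \<Rightarrow> 'a) A S"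
proof -
  have A: "sr_algebra A" and sat: "\<And>e. sr_satisfies S e \<Longrightarrow> sr_satisfies A e"
    using AS by (auto simp: variety_generated_iff[OF S])
  define I where "I = (UNIV :: 'b set) \<rightarrow> carrier S"
  define T where "T = {t :: 'b sr_term. set_sr_term t \<subseteq> carrier A}"
  define ev where "ev t = (\<lambda>v\<in>I. sr_eval S v t)" for t :: "'b sr_term"
  define B where "B = ev ` T"
  let ?P = "(sr_power I S)\<lparr>carrier := B\<rparr>"
  have kernel: "sr_eval A id s = sr_eval A id t"
    if s: "s \<in> T" and t: "t \<in> T" and eq: "ev s = ev t" for s t
  proof -
    let ?V = "set_sr_term s \<union> set_sr_term t"
    have "finite (set_sr_term u)" for u :: "'b sr_term"
      by (induction u) auto
    then obtain f :: "'b \<Rightarrow> nat" where f: "inj_on f ?V"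
      by (metis finite_UnI finite_imp_inj_to_nat_seg)
    have "sr_satisfies S (map_sr_term f s, map_sr_term f t)"
      unfolding sr_satisfies_def fst_conv snd_conv sr_eval_map
    proof (intro allI impI)
      fix w :: "nat \<Rightarrow> 'a" assume "range w \<subseteq> carrier S"
      then have "w \<circ> f \<in> I"
        by (auto simp: I_def)
      then show "sr_eval S (w \<circ> f) s = sr_eval S (w \<circ> f) t"
        using fun_cong[OF eq, of "w \<circ> f"] by (simp add: ev_def)
    qed
    then have "sr_satisfies A (map_sr_term f s, map_sr_term f t)"
      by (rule sat)
    moreover define u where "u n = (if n \<in> f ` ?V then inv_into ?V f n else \<zero>\<^bsub>A\<^esub>)" for n
    moreover have "range u \<subseteq> carrier A"
    proof (rule image_subsetI)
      fix n
      show "u n \<in> carrier A"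
      proof (cases "n \<in> f ` ?V")
        case True
        then have "inv_into ?V f n \<in> ?V" by (rule inv_into_into)
        then show ?thesis using True s t by (auto simp: u_def T_def)
      next
        case False
        then show ?thesis using A by (simp add: u_def sr_algebra_def)
      qed
    qed
    ultimately have "sr_eval A (u \<circ> f) s = sr_eval A (u \<circ> f) t"
      by (auto simp: sr_satisfies_def sr_eval_map)
    moreover have "(u \<circ> f) x = id x" if "x \<in> ?V" for x
      using that f by (simp add: u_def)
    ultimately show ?thesis
      by (metis (no_types, lifting) UnCI sr_eval_cong)
  qed
  define h where "h g = sr_eval A id (SOME t. t \<in> T \<and> ev t = g)" for g
  have h_ev: "h (ev t) = sr_eval A id t" if t: "t \<in> T" for t
  proof -
    have "(SOME s. s \<in> T \<and> ev s = ev t) \<in> T \<and> ev (SOME s. s \<in> T \<and> ev s = ev t) = ev t"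
      by (rule someI[of _ t]) (simp add: t)
    then show ?thesis
      unfolding h_def using kernel[OF _ t] by blast
  qed
  have ops: "TZero \<in> T" "TOne \<in> T" "\<zero>\<^bsub>sr_power I S\<^esub> = ev TZero" "\<one>\<^bsub>sr_power I S\<^esub> = ev TOne"
    "\<And>s t. s \<in> T \<Longrightarrow> t \<in> T \<Longrightarrow> TAdd s t \<in> T" "\<And>s t. s \<in> T \<Longrightarrow> t \<in> T \<Longrightarrow> TMult s t \<in> T"
    "\<And>s t. ev s \<oplus>\<^bsub>sr_power I S\<^esub> ev t = ev (TAdd s t)"
    "\<And>s t. ev s \<otimes>\<^bsub>sr_power I S\<^esub> ev t = ev (TMult s t)"
    by (auto simp: T_def ev_def sr_power_def)
  have hB: "h ` B = carrier A"
  proof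
    show "h ` B \<subseteq> carrier A"
      by (auto simp: B_def h_ev) (auto simp: T_def intro!: sr_eval_closed[OF A])
    show "carrier A \<subseteq> h ` B"
    proof
      fix x assume "x \<in> carrier A"
      then have "TVar x \<in> T" by (simp add: T_def)
      then show "x \<in> h ` B"
        using h_ev[of "TVar x"] by (force simp: B_def)
    qed
  qed
  have "B \<subseteq> carrier (sr_power I S)"
    by (auto simp: B_def ev_def sr_power_def I_def Pi_iff intro!: sr_eval_closed[OF S]
        split: if_splits)
  moreover have "sr_algebra ?P"
    unfolding sr_algebra_def B_def by (auto simp: ops)
  ultimately have "sr_subalgebra B (sr_power I S)"
    by (simp add: sr_subalgebra_def)
  moreover have "h \<in> sr_hom ?P A"
    using hB by (auto simp: sr_hom_def ring_hom_def B_def ops h_ev)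
  ultimately show ?thesis
    unfolding in_HSP_def using A hB by blast
qed

theorem variety_generated_iff_HSP:
  fixes S :: "'a ring" and A :: "'b ring"
  assumes "sr_algebra S"
  shows "A \<in> variety_generated S \<longleftrightarrow> in_HSP TYPE('b \<Rightarrow> 'a) A S"
  using assms in_HSP_imp_variety_generated variety_generated_imp_in_HSP by blast

end

(* Write a term as a sum of monomials, that is, of finite sets of variables. In a member of V a sum
   absorbs every monomial N that contains at least two of its summands A and B, since
   A + B = A + B + A B N. So the value of a sum depends only on the summands that contain no other
   summand (counted with multiplicity), together with the sets N that contain at least two summands.
   If 1 + 1 ~= 1 holds in S, then 0, 1 and 1 + 1 are distinct, and the valuation
   that is 1 on N and 0 elsewhere shows how many summands N contains, up to the cut-off two.
   An identity of S therefore holds throughout V. *)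

theory Submission
  imports Defs
begin

section \<open>Members of V as a locale\<close>

locale V_semiring = semiring R + comm_monoid R for R :: "'a ring" (structure) +
  assumes mult_idem: "x \<in> carrier R \<Longrightarrow> x \<otimes> x = x"
    and add_absorb: "\<lbrakk>x \<in> carrier R; y \<in> carrier R; z \<in> carrier R\<rbrakk>
      \<Longrightarrow> x \<oplus> y \<oplus> x \<otimes> y \<otimes> z = x \<oplus> y"

lemma variety_V_iff: "R \<in> variety_V \<longleftrightarrow> V_semiring R"
proof
  assume R: "R \<in> variety_V"
  then interpret semiring R by (simp add: variety_V_def)
  show "V_semiring R"
    by unfold_locales (use R in \<open>auto simp: variety_V_def\<close>)
next
  assume "V_semiring R"
  then interpret V_semiring R .
  show "R \<in> variety_V"
    by (auto simp: variety_V_def semiring_axioms mult_idem add_absorb intro: m_comm)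
qed

lemma sr_algebra_variety_V: "R \<in> variety_V \<Longrightarrow> sr_algebra R"
proof -
  assume "R \<in> variety_V"
  then interpret V_semiring R by (simp add: variety_V_iff)
  show ?thesis by (simp add: sr_algebra_def)
qed


section \<open>Terms as lists of monomials\<close>

text \<open>Idempotence of multiplication lets a monomial be a set of variables, while 1 + 1 may
  differ from 1, so the summands form a list that keeps multiplicities. The empty list stands for 0
  and the empty set for 1.\<close>

primrec monomials :: "'v sr_term \<Rightarrow> 'v set list" where
  "monomials (TVar x) = [{x}]"
| "monomials TZero = []"
| "monomials TOne = [{}]"
| "monomials (TAdd s t) = monomials s @ monomials t"
| "monomials (TMult s t) = concat (map (\<lambda>A. map ((\<union>) A) (monomials t)) (monomials s))"

lemma finite_monomials: "A \<in> set (monomials t) \<Longrightarrow> finite A"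
  by (induction t arbitrary: A) auto

text \<open>When the variables in \<open>N\<close> are set to 1 and all others to 0, this is the
  number of summands with value 1.\<close>

definition count_below :: "'v set \<Rightarrow> 'v set list \<Rightarrow> nat" where
  "count_below N p = length (filter (\<lambda>A. A \<subseteq> N) p)"

lemma count_below_simps [simp]:
  "count_below N [] = 0"
  "count_below N (A # p) = (if A \<subseteq> N then 1 else 0) + count_below N p"
  by (auto simp: count_below_def)

lemma count_below_pos: "A \<in> set p \<Longrightarrow> A \<subseteq> N \<Longrightarrow> 0 < count_below N p"
  by (induction p) auto

lemma count_below_posE:
  assumes "0 < count_below N p"
  obtains A where "A \<in> set p" "A \<subseteq> N"
  using assms by (auto simp: count_below_def length_greater_0_conv filter_empty_conv
      simp del: neq0_conv)

lemma count_below_filter: "count_below N (filter P p) \<le> count_below N p"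
  by (induction p) auto

text \<open>Different \<open>A\<close> and \<open>B\<close> would sit at two positions of the list
  and push the count to two.\<close>

lemma count_below_unique:
  assumes "count_below N p < 2" "A \<in> set p" "B \<in> set p" "A \<subseteq> N" "B \<subseteq> N"
  shows "A = B"
  using assms
proof (induction p)
  case (Cons C p)
  then show ?case
    using count_below_pos[of A p N] count_below_pos[of B p N] by (auto split: if_splits)
qed simp

text \<open>The count includes \<open>A\<close> itself, so the isolated monomials are those
  that contain no other entry of the list.\<close>

definition isolated :: "'v set list \<Rightarrow> 'v set list" where
  "isolated p = filter (\<lambda>A. count_below A p < 2) p"

text \<open>A repeated entry is counted twice below itself. Distinctness later turns the isolated
  part into a sum over a set.\<close>

lemma distinct_isolated: "distinct (isolated p)"
proof (rule ccontr)
  assume "\<not> distinct (isolated p)"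
  then obtain xs ys zs A where eq: "isolated p = xs @ [A] @ ys @ [A] @ zs"
    using not_distinct_decomp by blast
  then have "A \<in> set (isolated p)" by simp
  then have "count_below A p < 2" by (simp add: isolated_def)
  moreover have "count_below A (isolated p) \<le> count_below A p"
    unfolding isolated_def by (rule count_below_filter)
  moreover have "2 \<le> count_below A (isolated p)"
    unfolding eq count_below_def by simp
  ultimately show False by simp
qed

text \<open>The counts cut off at two already determine the isolated monomials. Passing from
  \<open>A\<close> in \<open>p\<close> to some \<open>B\<close> inside \<open>A\<close> in
  \<open>q\<close>, and back to some \<open>C\<close> inside \<open>B\<close> in \<open>p\<close>,
  forces all three to coincide.\<close>

lemma set_isolated_subset:
  assumes eq: "\<And>N. min 2 (count_below N p) = min 2 (count_below N q)"
  shows "set (isolated p) \<subseteq> set (isolated q)"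
proof
  fix A assume "A \<in> set (isolated p)"
  then have A: "A \<in> set p" "count_below A p < 2" by (auto simp: isolated_def)
  have qA: "count_below A q < 2" "0 < count_below A q"
    using eq[of A] A(2) count_below_pos[OF A(1), of A] by auto
  then obtain B where B: "B \<in> set q" "B \<subseteq> A" by (auto elim: count_below_posE)
  have "0 < count_below B p"
    using count_below_pos[OF B(1), of B] eq[of B] by auto
  then obtain C where "C \<in> set p" "C \<subseteq> B" by (auto elim: count_below_posE)
  with A B have "C = A" by (intro count_below_unique[of A p]) auto
  with \<open>C \<subseteq> B\<close> B have "B = A" by blast
  with B qA show "A \<in> set (isolated q)" by (simp add: isolated_def)
qed


section \<open>Evaluating lists of monomials\<close>

context V_semiring
begin

section \<open>Products of variables under idempotent multiplication\<close>

lemma finprod_insert_idem: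
  assumes "finite A" "v \<in> A \<rightarrow> carrier R" "v x \<in> carrier R"
  shows "finprod R v (insert x A) = v x \<otimes> finprod R v A"
proof (cases "x \<in> A")
  case True
  \<comment> \<open>The factor \<open>v x\<close> is split off the product over \<open>A\<close>,
    where idempotence merges it with the new copy.\<close>
  then obtain B where B: "A = insert x B" "x \<notin> B" by (meson Set.set_insert)
  then have "finprod R v A = v x \<otimes> finprod R v B" "finprod R v B \<in> carrier R"
    using assms by (auto simp: Pi_iff intro: finprod_closed)
  then show ?thesis
    using True assms(3) by (simp add: insert_absorb m_assoc[symmetric] mult_idem)
next
  case False
  then show ?thesis using assms by simp
qed

text \<open>Variables common to \<open>A\<close> and \<open>B\<close> occur twice on the right,
  which idempotence permits. Hence union of sets represents multiplication of monomials.\<close>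

lemma finprod_Un_idem:
  assumes "finite A" "finite B" "v \<in> A \<union> B \<rightarrow> carrier R"
  shows "finprod R v (A \<union> B) = finprod R v A \<otimes> finprod R v B"
  using assms(1,3)
proof (induction A)
  case empty
  then show ?case by (simp add: finprod_closed)
next
  case (insert x A)
  have "v \<in> A \<rightarrow> carrier R" "v \<in> B \<rightarrow> carrier R" "v x \<in> carrier R" "v \<in> A \<union> B \<rightarrow> carrier R"
    using insert.prems by auto
  then show ?case
    using insert assms(2)
    by (simp add: finprod_insert_idem m_assoc finprod_closed del: finprod_insert)
qed

text \<open>A fold over the list rather than \<open>finsum\<close> over its set, so that repeated
  monomials are added repeatedly.\<close>

definition poly_eval :: "('v \<Rightarrow> 'a) \<Rightarrow> 'v set list \<Rightarrow> 'a" where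
  "poly_eval v p = foldr (\<lambda>A. (\<oplus>) (finprod R v A)) p \<zero>"

lemma poly_eval_simps [simp]:
  "poly_eval v [] = \<zero>" "poly_eval v (A # p) = finprod R v A \<oplus> poly_eval v p"
  by (simp_all add: poly_eval_def)

section \<open>Sums of monomials under a fixed valuation\<close>

context
  fixes v :: "'v \<Rightarrow> 'a"
  assumes v: "range v \<subseteq> carrier R"
begin

lemma v_Pi [simp]: "v \<in> A \<rightarrow> carrier R"
  using v by auto

lemma finprod_v_closed [simp]: "finprod R v A \<in> carrier R"
  by (simp add: finprod_closed)

lemma poly_eval_closed [simp]: "poly_eval v p \<in> carrier R"
  by (induction p) simp_all

lemma poly_eval_append: "poly_eval v (p @ q) = poly_eval v p \<oplus> poly_eval v q"
  by (induction p) (simp_all add: a_assoc)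

lemma poly_eval_map_Un:
  assumes "finite A" "\<forall>B\<in>set p. finite B"
  shows "poly_eval v (map ((\<union>) A) p) = finprod R v A \<otimes> poly_eval v p"
  using assms(2) by (induction p) (simp_all add: assms(1) finprod_Un_idem r_distr)

lemma poly_eval_products:
  assumes "\<forall>A\<in>set p. finite A" "\<forall>B\<in>set q. finite B"
  shows "poly_eval v (concat (map (\<lambda>A. map ((\<union>) A) q) p)) = poly_eval v p \<otimes> poly_eval v q"
  using assms(1)
  by (induction p) (simp_all add: assms(2) poly_eval_append poly_eval_map_Un l_distr)

text \<open>Distributivity expands products of sums, and idempotence turns products of monomials
  into unions.\<close>

lemma sr_eval_eq_poly_eval: "sr_eval R v t = poly_eval v (monomials t)"
proof (induction t)
  case (TVar x)
  have "v x \<in> carrier R" using v by auto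
  then show ?case by (simp add: finprod_insert)
qed (simp_all add: poly_eval_append poly_eval_products finite_monomials)

section \<open>Absorption of monomials that are not isolated\<close>

lemma poly_eval_partition:
  "poly_eval v p = poly_eval v (filter P p) \<oplus> poly_eval v (filter (\<lambda>A. \<not> P A) p)"
  by (induction p) (simp_all add: a_ac)

text \<open>Allows isolated parts to be compared as sets, whatever the order of their
  entries.\<close>

lemma poly_eval_distinct: "distinct p \<Longrightarrow> poly_eval v p = finsum R (finprod R v) (set p)"
  by (induction p) (simp_all add: finsum_insert)

text \<open>The product over \<open>N\<close> contains those over \<open>A\<close> and
  \<open>B\<close> as factors, so it has the form x y z in the identity x + y + x y z = x + y of
  V.\<close>

lemma add_monomial_absorb:
  assumes "finite N" "A \<subseteq> N" "B \<subseteq> N"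
  shows "finprod R v A \<oplus> finprod R v B \<oplus> finprod R v N = finprod R v A \<oplus> finprod R v B"
proof -
  have fin: "finite A" "finite B" using assms finite_subset by auto
  have "N = A \<union> B \<union> N" using assms by blast
  then have "finprod R v N = finprod R v A \<otimes> finprod R v B \<otimes> finprod R v N"
    using finprod_Un_idem[of "A \<union> B" N v] finprod_Un_idem[of A B v] fin assms(1) by simp
  then show ?thesis by (metis add_absorb finprod_v_closed)
qed

text \<open>One monomial inside \<open>N\<close> is already at hand as \<open>A\<close>; the
  induction searches the list for a second one.\<close>

lemma poly_eval_absorb1:
  assumes "finite N" "A \<subseteq> N" "0 < count_below N p"
  shows "finprod R v A \<oplus> poly_eval v p \<oplus> finprod R v N = finprod R v A \<oplus> poly_eval v p"
  using assms(3)
proof (induction p)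
  case (Cons B p)
  let ?a = "finprod R v A" and ?b = "finprod R v B" and ?n = "finprod R v N"
    and ?p = "poly_eval v p"
  show ?case
  proof (cases "B \<subseteq> N")
    case True
    have "?a \<oplus> (?b \<oplus> ?p) \<oplus> ?n = (?a \<oplus> ?b \<oplus> ?n) \<oplus> ?p" by (simp add: a_ac)
    also have "\<dots> = ?a \<oplus> ?b \<oplus> ?p" using add_monomial_absorb[OF assms(1,2) True] by simp
    finally show ?thesis by (simp add: a_assoc)
  next
    case False
    have "?a \<oplus> (?b \<oplus> ?p) \<oplus> ?n = ?b \<oplus> (?a \<oplus> ?p \<oplus> ?n)" by (simp add: a_ac)
    also have "\<dots> = ?b \<oplus> (?a \<oplus> ?p)" using Cons False by simp
    finally show ?thesis by (simp add: a_ac)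
  qed
qed simp

text \<open>The first entry inside \<open>N\<close> is found by induction;
  \<open>poly_eval_absorb1\<close> finds the second in the tail.\<close>

lemma poly_eval_absorb:
  assumes "finite N" "2 \<le> count_below N p"
  shows "poly_eval v p \<oplus> finprod R v N = poly_eval v p"
  using assms(2)
proof (induction p)
  case (Cons A p)
  show ?case
  proof (cases "A \<subseteq> N")
    case True
    then show ?thesis using Cons.prems poly_eval_absorb1[OF assms(1) True] by simp
  next
    case False
    then show ?thesis using Cons by (simp add: a_assoc)
  qed
qed simp

lemma poly_eval_absorb_list:
  assumes "\<forall>N\<in>set q. finite N \<and> 2 \<le> count_below N p"
  shows "poly_eval v p \<oplus> poly_eval v q = poly_eval v p"
  using assms by (induction q) (simp_all add: a_assoc[symmetric] poly_eval_absorb)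

text \<open>The isolated parts agree, and each sum absorbs the remaining monomials of the
  other.\<close>

lemma poly_eval_eqI:
  assumes eq: "\<And>N. min 2 (count_below N p) = min 2 (count_below N q)"
    and fin: "\<forall>A\<in>set p \<union> set q. finite A"
  shows "poly_eval v p = poly_eval v q"
proof -
  have ge: "2 \<le> count_below N p \<longleftrightarrow> 2 \<le> count_below N q" for N
    using eq[of N] by auto
  let ?p2 = "filter (\<lambda>A. \<not> count_below A p < 2) p" and ?q2 = "filter (\<lambda>A. \<not> count_below A q < 2) q"
  have "set (isolated p) = set (isolated q)"
    using set_isolated_subset[OF eq] set_isolated_subset[OF eq[symmetric]] by blast
  then have iso: "poly_eval v (isolated p) = poly_eval v (isolated q)"
    by (simp add: poly_eval_distinct distinct_isolated)
  have p: "poly_eval v p = poly_eval v (isolated p) \<oplus> poly_eval v ?p2"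
    unfolding isolated_def by (rule poly_eval_partition)
  have q: "poly_eval v q = poly_eval v (isolated q) \<oplus> poly_eval v ?q2"
    unfolding isolated_def by (rule poly_eval_partition)
  \<comment> \<open>Each monomial in \<open>?q2\<close> contains two entries of \<open>q\<close>,
    hence by \<open>ge\<close> also two entries of \<open>p\<close>.\<close>
  have "poly_eval v p = poly_eval v p \<oplus> poly_eval v ?q2"
    using fin ge by (intro poly_eval_absorb_list[symmetric]) (auto simp: not_less)
  \<comment> \<open>Both sides consist of the common isolated part together with \<open>?p2\<close>
    and \<open>?q2\<close>.\<close>
  also have "\<dots> = poly_eval v q \<oplus> poly_eval v ?p2"
    by (simp add: p q iso a_ac)
  also have "\<dots> = poly_eval v q"
    using fin ge by (intro poly_eval_absorb_list) (auto simp: not_less)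
  finally show ?thesis .
qed

end

section \<open>Indicator valuations recover the counts\<close>

lemma poly_eval_indicator:
  fixes p :: "'v set list"
  assumes "\<forall>A\<in>set p. finite A"
  shows "poly_eval (\<lambda>x. if x \<in> N then \<one> else \<zero>) p =
    (if count_below N p = 0 then \<zero> else if count_below N p = 1 then \<one> else \<one> \<oplus> \<one>)"
proof -
  let ?v = "\<lambda>x. if x \<in> N then \<one> else \<zero>"
  \<comment> \<open>A variable of \<open>A\<close> outside \<open>N\<close> contributes a factor 0;
    otherwise all factors are 1.\<close>
  have mon: "finprod R ?v A = (if A \<subseteq> N then \<one> else \<zero>)" if "finite A" for A :: "'v set"
    using that
  proof (induction A)
    case (insert x A)
    moreover have "?v \<in> A \<rightarrow> carrier R" by auto
    ultimately show ?case by auto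
  qed simp
  \<comment> \<open>The identity of V at x = y = z = 1 is the source of the cut-off at two.\<close>
  have "\<one> \<oplus> (\<one> \<oplus> \<one>) = \<one> \<oplus> \<one>"
    using add_absorb[of \<one> \<one> \<one>] by (simp add: a_assoc)
  then show ?thesis
    using assms by (induction p) (auto simp: mon)
qed

text \<open>If 1 = 0, then 1 + 1 = 0 + 1 = 1. If 1 + 1 = 0, then 1 = 1 + 1 + 1 = 1 + 1 = 0.\<close>

lemma indicator_values_distinct:
  assumes "\<one> \<oplus> \<one> \<noteq> \<one>"
  shows "\<one> \<noteq> \<zero>" "\<one> \<oplus> \<one> \<noteq> \<zero>"
proof -
  show "\<one> \<noteq> \<zero>" using assms by (metis l_zero zero_closed)
  have "\<one> \<oplus> \<one> \<oplus> \<one> = \<one> \<oplus> \<one>"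
    using add_absorb[of \<one> \<one> \<one>] by simp
  then show "\<one> \<oplus> \<one> \<noteq> \<zero>" using \<open>\<one> \<noteq> \<zero>\<close> by (metis l_zero one_closed)
qed

text \<open>The identity is evaluated at the indicator of \<open>N\<close>; the values 0, 1 and 1 +
  1 are distinct and so reveal the counts up to two.\<close>

lemma satisfies_imp_count_below_eq:
  assumes "\<one> \<oplus> \<one> \<noteq> \<one>" "sr_satisfies R (s, t)"
  shows "min 2 (count_below N (monomials s)) = min 2 (count_below N (monomials t))"
proof -
  let ?v = "\<lambda>x. if x \<in> N then \<one> else \<zero>"
  have v: "range ?v \<subseteq> carrier R" by auto
  then have "poly_eval ?v (monomials s) = poly_eval ?v (monomials t)"
    using assms(2)
    by (simp only: sr_satisfies_def fst_conv snd_conv sr_eval_eq_poly_eval[OF v, symmetric])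
  then show ?thesis
    using indicator_values_distinct[OF assms(1)] assms(1)
    by (auto simp: poly_eval_indicator finite_monomials split: if_splits)
qed

end


section \<open>The variety $\mathcal{V}$\<close>

text \<open>An equational base of V. Unit, zero and distributive laws are one-sided because
  commutativity of both operations yields the other side.\<close>

definition V_identities :: "sr_identity set" where
  "V_identities =
    (let x = TVar 0; y = TVar 1; z = TVar 2 in
     {(TAdd (TAdd x y) z, TAdd x (TAdd y z)), (TAdd x y, TAdd y x), (TAdd TZero x, x),
      (TMult (TMult x y) z, TMult x (TMult y z)), (TMult x y, TMult y x), (TMult TOne x, x),
      (TMult (TAdd x y) z, TAdd (TMult x z) (TMult y z)), (TMult TZero x, TZero),
      (TMult x x, x), (TAdd (TAdd x y) (TMult (TMult x y) z), TAdd x y)})"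

text \<open>Makes V one of the equational classes whose intersection is
  \<open>variety_generated\<close>.\<close>

lemma sr_models_V_identities: "sr_models V_identities = variety_V"
proof (intro equalityI subsetI)
  fix R :: "'a ring" assume "R \<in> variety_V"
  then interpret V_semiring R by (simp add: variety_V_iff)
  have "sr_satisfies R e" if "e \<in> V_identities" for e
    unfolding sr_satisfies_def
  proof (intro allI impI)
    fix v :: "nat \<Rightarrow> 'a" assume "range v \<subseteq> carrier R"
    then have "v n \<in> carrier R" for n by auto
    then show "sr_eval R v (fst e) = sr_eval R v (snd e)"
      using that
      by (auto simp: V_identities_def Let_def l_distr mult_idem add_absorb)
        (simp_all add: a_ac m_ac)
  qed
  then show "R \<in> sr_models V_identities"
    using \<open>R \<in> variety_V\<close> by (simp add: sr_models_def sr_algebra_variety_V)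
next
  fix R :: "'a ring" assume R: "R \<in> sr_models V_identities"
  then have alg: "\<zero>\<^bsub>R\<^esub> \<in> carrier R" "\<one>\<^bsub>R\<^esub> \<in> carrier R"
    "\<And>x y. x \<in> carrier R \<Longrightarrow> y \<in> carrier R \<Longrightarrow> x \<oplus>\<^bsub>R\<^esub> y \<in> carrier R"
    "\<And>x y. x \<in> carrier R \<Longrightarrow> y \<in> carrier R \<Longrightarrow> x \<otimes>\<^bsub>R\<^esub> y \<in> carrier R"
    by (auto simp: sr_models_def sr_algebra_def)
  \<comment> \<open>Variables 0, 1 and 2 receive x, y and z; all later ones also receive z, which
    keeps the range inside the carrier.\<close>
  let ?v = "\<lambda>x y z n :: nat. if n = 0 then x else if n = 1 then y else z"
  have ids: "\<forall>e\<in>V_identities. sr_eval R (?v x y z) (fst e) = sr_eval R (?v x y z) (snd e)"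
    if "x \<in> carrier R" "y \<in> carrier R" "z \<in> carrier R" for x y z
  proof -
    have "range (?v x y z) \<subseteq> carrier R" using that by auto
    then show ?thesis using R by (simp only: sr_models_def sr_satisfies_def) blast
  qed
  note ids = ids[unfolded V_identities_def Let_def, simplified]
  \<comment> \<open>Identities in at most two variables, with y also used for the third.\<close>
  have id2: "x \<oplus>\<^bsub>R\<^esub> y = y \<oplus>\<^bsub>R\<^esub> x" "x \<otimes>\<^bsub>R\<^esub> y = y \<otimes>\<^bsub>R\<^esub> x"
    "\<zero>\<^bsub>R\<^esub> \<oplus>\<^bsub>R\<^esub> x = x" "\<one>\<^bsub>R\<^esub> \<otimes>\<^bsub>R\<^esub> x = x" "\<zero>\<^bsub>R\<^esub> \<otimes>\<^bsub>R\<^esub> x = \<zero>\<^bsub>R\<^esub>" "x \<otimes>\<^bsub>R\<^esub> x = x"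
    if "x \<in> carrier R" "y \<in> carrier R" for x y
    using ids[OF that that(2)] by blast+
  have id3: "x \<oplus>\<^bsub>R\<^esub> y \<oplus>\<^bsub>R\<^esub> z = x \<oplus>\<^bsub>R\<^esub> (y \<oplus>\<^bsub>R\<^esub> z)"
    "x \<otimes>\<^bsub>R\<^esub> y \<otimes>\<^bsub>R\<^esub> z = x \<otimes>\<^bsub>R\<^esub> (y \<otimes>\<^bsub>R\<^esub> z)"
    "(x \<oplus>\<^bsub>R\<^esub> y) \<otimes>\<^bsub>R\<^esub> z = x \<otimes>\<^bsub>R\<^esub> z \<oplus>\<^bsub>R\<^esub> y \<otimes>\<^bsub>R\<^esub> z"
    "x \<oplus>\<^bsub>R\<^esub> y \<oplus>\<^bsub>R\<^esub> x \<otimes>\<^bsub>R\<^esub> y \<otimes>\<^bsub>R\<^esub> z = x \<oplus>\<^bsub>R\<^esub> y"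
    if "x \<in> carrier R" "y \<in> carrier R" "z \<in> carrier R" for x y z
    using ids[OF that] by blast+
  have "abelian_monoid R"
    using alg id2 id3 by (intro abelian_monoidI) auto
  moreover have cm: "comm_monoid R"
    using alg id2 id3 by (intro comm_monoidI) auto
  moreover have "semiring_axioms R"
  proof
    fix x y z assume "x \<in> carrier R" "y \<in> carrier R" "z \<in> carrier R"
    then show "(x \<oplus>\<^bsub>R\<^esub> y) \<otimes>\<^bsub>R\<^esub> z = x \<otimes>\<^bsub>R\<^esub> z \<oplus>\<^bsub>R\<^esub> y \<otimes>\<^bsub>R\<^esub> z"
      "z \<otimes>\<^bsub>R\<^esub> (x \<oplus>\<^bsub>R\<^esub> y) = z \<otimes>\<^bsub>R\<^esub> x \<oplus>\<^bsub>R\<^esub> z \<otimes>\<^bsub>R\<^esub> y"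
      using alg id3(3)[of x y z] id2(2)[of z] by auto
  next
    fix x assume "x \<in> carrier R"
    then show "\<zero>\<^bsub>R\<^esub> \<otimes>\<^bsub>R\<^esub> x = \<zero>\<^bsub>R\<^esub>" "x \<otimes>\<^bsub>R\<^esub> \<zero>\<^bsub>R\<^esub> = \<zero>\<^bsub>R\<^esub>"
      using alg id2(5)[of x x] id2(2)[of x "\<zero>\<^bsub>R\<^esub>"] by auto
  qed
  ultimately show "R \<in> variety_V"
    using id2(2,6) id3(4)
    by (simp add: variety_V_def semiring_def comm_monoid.axioms(1))
qed

theorem variety_generated_eq_V:
  assumes "S \<in> variety_V" "\<one>\<^bsub>S\<^esub> \<oplus>\<^bsub>S\<^esub> \<one>\<^bsub>S\<^esub> \<noteq> \<one>\<^bsub>S\<^esub>"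
  shows "variety_generated S = variety_V"
proof (intro equalityI subsetI)
  fix A :: "'b ring" assume "A \<in> variety_generated S"
  moreover have "S \<in> sr_models V_identities"
    using assms(1) by (simp add: sr_models_V_identities)
  ultimately have "A \<in> sr_models V_identities"
    unfolding variety_generated_def by blast
  then show "A \<in> variety_V" by (simp add: sr_models_V_identities)
next
  fix A :: "'b ring" assume A: "A \<in> variety_V"
  interpret S: V_semiring S using assms(1) by (simp add: variety_V_iff)
  interpret A: V_semiring A using A by (simp add: variety_V_iff)
  \<comment> \<open>The identity transfers because \<open>S\<close> forces equal cut-off counts for
    \<open>s\<close> and \<open>t\<close>, and these counts fix the value in
    \<open>A\<close>.\<close>
  have "sr_satisfies A (s, t)" if "sr_satisfies S (s, t)" for s t
    unfolding sr_satisfies_def fst_conv snd_conv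
  proof (intro allI impI)
    fix v :: "nat \<Rightarrow> 'b" assume v: "range v \<subseteq> carrier A"
    show "sr_eval A v s = sr_eval A v t"
      unfolding A.sr_eval_eq_poly_eval[OF v]
      using S.satisfies_imp_count_below_eq[OF assms(2) that]
      by (intro A.poly_eval_eqI[OF v]) (auto intro: finite_monomials)
  qed
  then show "A \<in> variety_generated S"
    using A assms(1) by (auto simp: variety_generated_iff sr_algebra_variety_V)
qed


section \<open>The semirings $\mathbf{L}\oplus 1$ and $\mathbf{T}_3$\<close>

lemma T3_in_variety_V: "T3 \<in> variety_V"
proof -
  \<comment> \<open>Quantifiers become finite conjunctions, so that the laws are checked on the
    operation tables.\<close>
  have T3_UNIV: "(\<forall>x. P x) \<longleftrightarrow> P T3_0 \<and> P T3_a \<and> P T3_1" for P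
    by (metis T3_elem.exhaust)
  have "abelian_monoid T3"
    by (intro abelian_monoidI) (auto simp: T3_def)
  moreover have "monoid T3"
    by (intro monoidI) (auto simp: T3_def)
  moreover have "semiring_axioms T3"
    unfolding semiring_axioms_def by (simp add: T3_def T3_UNIV)
  ultimately have "semiring T3" by (simp add: semiring_def)
  then show ?thesis
    unfolding variety_V_def by (simp add: T3_def T3_UNIV)
qed

lemma T3_one_add_one: "\<one>\<^bsub>T3\<^esub> \<oplus>\<^bsub>T3\<^esub> \<one>\<^bsub>T3\<^esub> \<noteq> \<one>\<^bsub>T3\<^esub>"
  by (simp add: T3_def)

section \<open>Bounded distributive lattices with an adjoined unit\<close>

lemma adjoin_one_add_one:
  assumes "nontrivial_bounded_distrib_lattice L" "e \<notin> carrier L"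
  shows "\<one>\<^bsub>adjoin_one L e\<^esub> \<oplus>\<^bsub>adjoin_one L e\<^esub> \<one>\<^bsub>adjoin_one L e\<^esub> \<noteq> \<one>\<^bsub>adjoin_one L e\<^esub>"
proof -
  interpret bounded_lattice L
    using assms(1) by (simp add: nontrivial_bounded_distrib_lattice_def)
  \<comment> \<open>Since \<open>e\<close> is not the bottom, e + e takes the default value, the
    top, which in turn differs from \<open>e\<close>.\<close>
  have "\<bottom>\<^bsub>L\<^esub> \<noteq> e" "\<top>\<^bsub>L\<^esub> \<noteq> e" using assms(2) bottom_closed top_closed by metis+
  then show ?thesis by (simp add: adjoin_one_def)
qed

text \<open>Each law is split according to which arguments equal \<open>e\<close>: without
  \<open>e\<close> it is a lattice law, and otherwise the rules for bottom, top and absorption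
  settle it.\<close>

lemma adjoin_one_in_variety_V:
  assumes L: "nontrivial_bounded_distrib_lattice L" and e: "e \<notin> carrier L"
  shows "adjoin_one L e \<in> variety_V"
proof -
  interpret bounded_lattice L
    using L by (simp add: nontrivial_bounded_distrib_lattice_def)
  let ?R = "adjoin_one L e"
  have distr: "x \<sqinter>\<^bsub>L\<^esub> (y \<squnion>\<^bsub>L\<^esub> z) = (x \<sqinter>\<^bsub>L\<^esub> y) \<squnion>\<^bsub>L\<^esub> (x \<sqinter>\<^bsub>L\<^esub> z)"
    if "x \<in> carrier L" "y \<in> carrier L" "z \<in> carrier L" for x y z
    using L that by (simp add: nontrivial_bounded_distrib_lattice_def)
  have distr': "(y \<squnion>\<^bsub>L\<^esub> z) \<sqinter>\<^bsub>L\<^esub> x = (y \<sqinter>\<^bsub>L\<^esub> x) \<squnion>\<^bsub>L\<^esub> (z \<sqinter>\<^bsub>L\<^esub> x)"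
    if "x \<in> carrier L" "y \<in> carrier L" "z \<in> carrier L" for x y z
    using distr[OF that] by (simp add: meet_comm)
  have neq: "x \<noteq> e" if "x \<in> carrier L" for x using that e by blast
  have le_meet: "x \<sqinter>\<^bsub>L\<^esub> y = x" "y \<sqinter>\<^bsub>L\<^esub> x = x" if "x \<sqsubseteq>\<^bsub>L\<^esub> y" "x \<in> carrier L" "y \<in> carrier L" for x y
    using that le_iff_join meet_comm by metis+
  have le_join: "x \<squnion>\<^bsub>L\<^esub> y = y" "y \<squnion>\<^bsub>L\<^esub> x = y" if "x \<sqsubseteq>\<^bsub>L\<^esub> y" "x \<in> carrier L" "y \<in> carrier L" for x y
    using that le_iff_meet join_comm by metis+
  have bot: "\<bottom>\<^bsub>L\<^esub> \<sqinter>\<^bsub>L\<^esub> x = \<bottom>\<^bsub>L\<^esub>" "x \<sqinter>\<^bsub>L\<^esub> \<bottom>\<^bsub>L\<^esub> = \<bottom>\<^bsub>L\<^esub>" "\<bottom>\<^bsub>L\<^esub> \<squnion>\<^bsub>L\<^esub> x = x" "x \<squnion>\<^bsub>L\<^esub> \<bottom>\<^bsub>L\<^esub> = x"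
    if "x \<in> carrier L" for x
    using that by (simp_all add: le_meet le_join bottom_lower)
  have top: "\<top>\<^bsub>L\<^esub> \<sqinter>\<^bsub>L\<^esub> x = x" "x \<sqinter>\<^bsub>L\<^esub> \<top>\<^bsub>L\<^esub> = x" "\<top>\<^bsub>L\<^esub> \<squnion>\<^bsub>L\<^esub> x = \<top>\<^bsub>L\<^esub>" "x \<squnion>\<^bsub>L\<^esub> \<top>\<^bsub>L\<^esub> = \<top>\<^bsub>L\<^esub>"
    if "x \<in> carrier L" for x
    using that by (simp_all add: le_meet le_join top_higher)
  have idem: "x \<sqinter>\<^bsub>L\<^esub> x = x" "x \<squnion>\<^bsub>L\<^esub> x = x" if "x \<in> carrier L" for x
    using that by (simp_all add: le_meet le_join)
  have m_assoc: "(x \<sqinter>\<^bsub>L\<^esub> y) \<sqinter>\<^bsub>L\<^esub> z = x \<sqinter>\<^bsub>L\<^esub> (y \<sqinter>\<^bsub>L\<^esub> z)"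
    if "x \<in> carrier L" "y \<in> carrier L" "z \<in> carrier L" for x y z
    using weak_meet_assoc[OF that] that by (simp add: eq_is_equal)
  have j_assoc: "(x \<squnion>\<^bsub>L\<^esub> y) \<squnion>\<^bsub>L\<^esub> z = x \<squnion>\<^bsub>L\<^esub> (y \<squnion>\<^bsub>L\<^esub> z)"
    if "x \<in> carrier L" "y \<in> carrier L" "z \<in> carrier L" for x y z
    using weak_join_assoc[OF that] that by (simp add: eq_is_equal)
  \<comment> \<open>Adding \<open>e\<close> branches on being bottom, so associativity has to know
    when a join is bottom.\<close>
  have join_bot: "x \<squnion>\<^bsub>L\<^esub> y = \<bottom>\<^bsub>L\<^esub> \<longleftrightarrow> x = \<bottom>\<^bsub>L\<^esub> \<and> y = \<bottom>\<^bsub>L\<^esub>"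
    if "x \<in> carrier L" "y \<in> carrier L" for x y
  proof
    assume "x \<squnion>\<^bsub>L\<^esub> y = \<bottom>\<^bsub>L\<^esub>"
    then have "x \<sqsubseteq>\<^bsub>L\<^esub> \<bottom>\<^bsub>L\<^esub>" "y \<sqsubseteq>\<^bsub>L\<^esub> \<bottom>\<^bsub>L\<^esub>"
      using join_left[OF that] join_right[OF that] by simp_all
    then show "x = \<bottom>\<^bsub>L\<^esub> \<and> y = \<bottom>\<^bsub>L\<^esub>"
      using that by (blast intro: le_antisym bottom_lower bottom_closed)
  qed (simp add: bot bottom_closed)
  \<comment> \<open>Serves distributivity when \<open>e\<close> is one of the summands: the product
    with \<open>e\<close> is the other factor itself, which absorbs its meets.\<close>
  have absorb: "x \<squnion>\<^bsub>L\<^esub> (x \<sqinter>\<^bsub>L\<^esub> y) = x" if "x \<in> carrier L" "y \<in> carrier L" for x y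
    using that by (simp add: le_join meet_left)
  \<comment> \<open>The identity of V inside the lattice: the triple meet lies below x, hence below
    the join of x and y.\<close>
  have absorb3: "(x \<squnion>\<^bsub>L\<^esub> y) \<squnion>\<^bsub>L\<^esub> ((x \<sqinter>\<^bsub>L\<^esub> y) \<sqinter>\<^bsub>L\<^esub> z) = x \<squnion>\<^bsub>L\<^esub> y"
    if "x \<in> carrier L" "y \<in> carrier L" "z \<in> carrier L" for x y z
  proof (rule le_join)
    have "(x \<sqinter>\<^bsub>L\<^esub> y) \<sqinter>\<^bsub>L\<^esub> z \<sqsubseteq>\<^bsub>L\<^esub> x \<sqinter>\<^bsub>L\<^esub> y" "x \<sqinter>\<^bsub>L\<^esub> y \<sqsubseteq>\<^bsub>L\<^esub> x" "x \<sqsubseteq>\<^bsub>L\<^esub> x \<squnion>\<^bsub>L\<^esub> y"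
      using that by (simp_all add: meet_left join_left)
    then show "(x \<sqinter>\<^bsub>L\<^esub> y) \<sqinter>\<^bsub>L\<^esub> z \<sqsubseteq>\<^bsub>L\<^esub> x \<squnion>\<^bsub>L\<^esub> y"
      using that by (meson le_trans meet_closed join_closed)
  qed (use that in simp_all)
  have carrier: "carrier ?R = insert e (carrier L)"
    and one: "\<one>\<^bsub>?R\<^esub> = e" and zero: "\<zero>\<^bsub>?R\<^esub> = \<bottom>\<^bsub>L\<^esub>"
    by (simp_all add: adjoin_one_def)
  have add: "x \<oplus>\<^bsub>?R\<^esub> y = x \<squnion>\<^bsub>L\<^esub> y" and mult: "x \<otimes>\<^bsub>?R\<^esub> y = x \<sqinter>\<^bsub>L\<^esub> y"
    if "x \<in> carrier L" "y \<in> carrier L" for x y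
    using neq[OF that(1)] neq[OF that(2)] by (simp_all add: adjoin_one_def)
  have mult_e: "x \<otimes>\<^bsub>?R\<^esub> e = x" "e \<otimes>\<^bsub>?R\<^esub> x = x" for x
    by (simp_all add: adjoin_one_def)
  \<comment> \<open>The case x = e is included and gives the top, as \<open>e\<close> differs from
    the bottom.\<close>
  have add_e: "x \<oplus>\<^bsub>?R\<^esub> e = (if x = \<bottom>\<^bsub>L\<^esub> then e else \<top>\<^bsub>L\<^esub>)"
    "e \<oplus>\<^bsub>?R\<^esub> x = (if x = \<bottom>\<^bsub>L\<^esub> then e else \<top>\<^bsub>L\<^esub>)" for x
    using neq[OF bottom_closed] by (auto simp: adjoin_one_def)
  have [simp]: "\<bottom>\<^bsub>L\<^esub> \<in> carrier L" "\<top>\<^bsub>L\<^esub> \<in> carrier L"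
    by (simp_all add: bottom_closed top_closed)
  have [simp]: "e \<noteq> \<bottom>\<^bsub>L\<^esub>" "\<bottom>\<^bsub>L\<^esub> \<noteq> e" "e \<noteq> \<top>\<^bsub>L\<^esub>" "\<top>\<^bsub>L\<^esub> \<noteq> e" "\<top>\<^bsub>L\<^esub> \<noteq> \<bottom>\<^bsub>L\<^esub>"
    using neq[OF bottom_closed] neq[OF top_closed] L
    by (auto simp: nontrivial_bounded_distrib_lattice_def)
  note facts = carrier one zero add add_e mult mult_e bot top idem join_bot
  have "abelian_monoid ?R"
  proof (rule abelian_monoidI)
    fix x y z assume "x \<in> carrier ?R" "y \<in> carrier ?R" "z \<in> carrier ?R"
    then show "x \<oplus>\<^bsub>?R\<^esub> y \<oplus>\<^bsub>?R\<^esub> z = x \<oplus>\<^bsub>?R\<^esub> (y \<oplus>\<^bsub>?R\<^esub> z)"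
      by (auto simp: facts j_assoc)
  next
    fix x y assume "x \<in> carrier ?R" "y \<in> carrier ?R"
    then show "x \<oplus>\<^bsub>?R\<^esub> y \<in> carrier ?R" "x \<oplus>\<^bsub>?R\<^esub> y = y \<oplus>\<^bsub>?R\<^esub> x"
      by (auto simp: facts join_comm[of L x y] split: if_splits)
  qed (auto simp: facts)
  moreover have "monoid ?R"
    by (rule monoidI) (auto simp: facts m_assoc)
  moreover have "semiring_axioms ?R"
  proof
    fix x y z assume "x \<in> carrier ?R" "y \<in> carrier ?R" "z \<in> carrier ?R"
    then show "(x \<oplus>\<^bsub>?R\<^esub> y) \<otimes>\<^bsub>?R\<^esub> z = x \<otimes>\<^bsub>?R\<^esub> z \<oplus>\<^bsub>?R\<^esub> y \<otimes>\<^bsub>?R\<^esub> z"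
      by (auto simp: facts distr' absorb le_join meet_left meet_right)
    show "z \<otimes>\<^bsub>?R\<^esub> (x \<oplus>\<^bsub>?R\<^esub> y) = z \<otimes>\<^bsub>?R\<^esub> x \<oplus>\<^bsub>?R\<^esub> z \<otimes>\<^bsub>?R\<^esub> y"
      using \<open>x \<in> carrier ?R\<close> \<open>y \<in> carrier ?R\<close> \<open>z \<in> carrier ?R\<close>
      by (auto simp: facts distr absorb le_join meet_left meet_right)
  qed (auto simp: facts)
  ultimately have "semiring ?R" by (simp add: semiring_def)
  moreover have "x \<otimes>\<^bsub>?R\<^esub> y = y \<otimes>\<^bsub>?R\<^esub> x" if "x \<in> carrier ?R" "y \<in> carrier ?R" for x y
    using that by (auto simp: facts meet_comm[of L x y])
  moreover have "x \<otimes>\<^bsub>?R\<^esub> x = x" if "x \<in> carrier ?R" for x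
    using that by (auto simp: facts)
  moreover have "x \<oplus>\<^bsub>?R\<^esub> y \<oplus>\<^bsub>?R\<^esub> x \<otimes>\<^bsub>?R\<^esub> y \<otimes>\<^bsub>?R\<^esub> z = x \<oplus>\<^bsub>?R\<^esub> y"
    if "x \<in> carrier ?R" "y \<in> carrier ?R" "z \<in> carrier ?R" for x y z
    \<comment> \<open>The instance with the top serves z = e, where multiplying by z leaves the meet
      of x and y unchanged.\<close>
    using that absorb3[of x y z] absorb3[of x y "\<top>\<^bsub>L\<^esub>"] by (auto simp: facts)
  ultimately show ?thesis
    unfolding variety_V_def by blast
qed

text \<open>The type \<open>'c\<close> of the members is separate from \<open>'a\<close> and
  \<open>'b\<close>, so the varieties are compared over an arbitrary element type.\<close>

theorem corollary4p2:
  "(\<forall>S :: 'a ring. S \<in> variety_V \<and> \<one>\<^bsub>S\<^esub> \<oplus>\<^bsub>S\<^esub> \<one>\<^bsub>S\<^esub> \<noteq> \<one>\<^bsub>S\<^esub> \<longrightarrow>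
      (variety_generated S :: 'c ring set) = variety_V) \<and>
   (\<forall>(L :: 'b gorder) e. nontrivial_bounded_distrib_lattice L \<and> e \<notin> carrier L \<longrightarrow>
      (variety_generated (adjoin_one L e) :: 'c ring set) = variety_V) \<and>
   (variety_generated T3 :: 'c ring set) = variety_V"
  by (simp add: variety_generated_eq_V adjoin_one_in_variety_V adjoin_one_add_one
      T3_in_variety_V T3_one_add_one)

end
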